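(* Let $q$ and $n$ be two coprime positive integers. Let $\mathcal{N}$ be the set of necklaces of length $n$ whose beads are colored from a set of $q$ colors, and let $\mathcal{F}$ be the set of functions $f:\mathbb{Z}_n\to\{0,1,\ldots,q-1\}$ such that $\sum_{z\in\mathbb{Z}_n} z\,f(z)\equiv 0 \pmod n$. Then \[ |\mathcal{N}|=|\mathcal{F}|=\sum_{I\subseteq\{1,\ldots,m\}} \frac{\gcd\big(n,\gcd(s_i)_{i\in I}\big)}{n}\,\prod_{i\in I}\big(q^{\ell_i}-1\big), \] where $m$, $s_i$, $\ell_i$ are as described in the context.
   Context: A necklace of length $n$ with $q$ colors is an equivalence class of words of length $n$ over a $q$-letter alphabet under cyclic rotation. $\mathbb{Z}_n$ denotes the integers modulo $n$. Consider the equivalence relation on $\mathbb{Z}_n$ generated by $z\sim qz$ (i.e. $z\sim q^jz$ for all $j\ge 0$). Let $s_1,\ldots,s_m$ be integers representing the $m$ equivalence classes; the class of $s_i$ is the cyclotomic coset $S_i=\{s_i,qs_i,\ldots,q^{\ell_i-1}s_i\}$, where $\ell_i$ is the smallest positive integer with $q^{\ell_i}s_i\equiv s_i\pmod n$. For $I=\emptyset$, $\gcd(n,\gcd(s_i)_{i\in I})$ is interpreted as $n$ (the empty product is $1$). *)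

theory Defs
  imports Complex_Main "HOL-Library.FuncSet" "HOL-Number_Theory.Cong"
begin

definition words :: "nat \<Rightarrow> 'c set \<Rightarrow> 'c list set" where
  "words n C = {w. length w = n \<and> set w \<subseteq> C}"

definition rotation_rel :: "nat \<Rightarrow> 'c set \<Rightarrow> ('c list \<times> 'c list) set" where
  "rotation_rel n C = {(u, v). u \<in> words n C \<and> v \<in> words n C \<and> (\<exists>k. v = rotate k u)}"

definition necklaces :: "nat \<Rightarrow> 'c set \<Rightarrow> 'c list set set" where
  "necklaces n C = words n C // rotation_rel n C"

text \<open>The integers modulo \<open>n\<close> are represented by their least nonnegative residues; an arbitrary
  integer \<open>s\<close> stands for the residue \<open>s mod n\<close>.\<close>

definition Zmod :: "nat \<Rightarrow> int set" where
  "Zmod n = {0..<int n}"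

definition zero_sum_functions :: "nat \<Rightarrow> nat \<Rightarrow> (int \<Rightarrow> int) set" where
  "zero_sum_functions q n =
     {f \<in> Zmod n \<rightarrow>\<^sub>E {0..<int q}. [(\<Sum>z\<in>Zmod n. z * f z) = 0] (mod int n)}"

text \<open>\<^const>\<open>equivclp\<close> is reflexive on the whole type, hence the restriction to \<^const>\<open>Zmod\<close>.\<close>

definition cyclotomic_rel :: "nat \<Rightarrow> nat \<Rightarrow> (int \<times> int) set" where
  "cyclotomic_rel q n =
     {(x, y). x \<in> Zmod n \<and> y \<in> Zmod n \<and>
        equivclp (\<lambda>a b. a \<in> Zmod n \<and> b = (int q * a) mod int n) x y}"

definition represents_classes :: "nat \<Rightarrow> nat \<Rightarrow> nat \<Rightarrow> (nat \<Rightarrow> int) \<Rightarrow> bool" where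
  "represents_classes q n m s \<longleftrightarrow>
     bij_betw (\<lambda>i. cyclotomic_rel q n `` {s i mod int n}) {1..m} (Zmod n // cyclotomic_rel q n)"

definition coset_length :: "nat \<Rightarrow> nat \<Rightarrow> int \<Rightarrow> nat" where
  "coset_length q n s = (LEAST l. 0 < l \<and> [int q ^ l * s = s] (mod int n))"

lemma equiv_rotation_rel: "equiv (words n C) (rotation_rel n C)"
proof (rule equivI)
  show "rotation_rel n C \<subseteq> words n C \<times> words n C"
    by (auto simp: rotation_rel_def)
  show "refl_on (words n C) (rotation_rel n C)"
    by (auto simp: rotation_rel_def refl_on_def intro: exI[of _ 0])
  show "sym (rotation_rel n C)"
  proof (rule symI)
    fix u v assume "(u, v) \<in> rotation_rel n C"
    then obtain k where k: "u \<in> words n C" "v \<in> words n C" "v = rotate k u"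
      by (auto simp: rotation_rel_def)
    have "u = rotate (n - k mod n) v"
    proof (cases "n = 0")
      case False
      have "length u = n" using k by (simp add: words_def)
      then have "v = rotate (k mod n) u" using k(3) rotate_conv_mod by metis
      then have "rotate (n - k mod n) v = rotate n u"
        using False by (simp add: rotate_rotate)
      then show ?thesis using \<open>length u = n\<close> by simp
    qed (use k in \<open>auto simp: words_def\<close>)
    then show "(v, u) \<in> rotation_rel n C" using k by (auto simp: rotation_rel_def)
  qed
  show "trans (rotation_rel n C)"
    by (rule transI) (auto simp: rotation_rel_def rotate_rotate)
qed

lemma equiv_cyclotomic_rel: "equiv (Zmod n) (cyclotomic_rel q n)"
proof (rule equivI)
  show "cyclotomic_rel q n \<subseteq> Zmod n \<times> Zmod n"
    by (auto simp: cyclotomic_rel_def)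
  show "refl_on (Zmod n) (cyclotomic_rel q n)"
    by (auto simp: cyclotomic_rel_def refl_on_def)
  show "sym (cyclotomic_rel q n)"
    by (rule symI) (auto simp: cyclotomic_rel_def intro: equivclp_sym)
  show "trans (cyclotomic_rel q n)"
    by (rule transI) (auto simp: cyclotomic_rel_def intro: equivclp_trans)
qed

end

theory Submission
  imports Defs
begin

text \<open>All three quantities equal \<open>1/n \<cdot> \<Sum>\<^sub>k q\<^bsup>gcd(k,n)\<^esup>\<close>, where \<open>k\<close> ranges over the residues
  modulo \<open>n\<close> and \<open>gcd(k,n)\<close> counts the residues \<open>z\<close> with \<open>n dvd k z\<close>. For necklaces this is orbit
  counting. For zero-sum functions, orthogonality of the characters \<open>z \<mapsto> \<zeta>\<^bsup>kz\<^esup>\<close> gives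
  \<open>1/n \<cdot> \<Sum>\<^sub>k \<Prod>\<^sub>z \<Sum>\<^sub>a\<^sub><\<^sub>q \<zeta>\<^bsup>kza\<^esup>\<close>: a factor with \<open>n dvd k z\<close> is \<open>q\<close>, and the other factors
  \<open>(\<zeta>\<^bsup>kqz\<^esup> - 1) / (\<zeta>\<^bsup>kz\<^esup> - 1)\<close> multiply to \<open>1\<close> because multiplication by \<open>q\<close> permutes those
  \<open>z\<close>. In the sum over \<open>I\<close>, the gcd counts the \<open>k\<close> with \<open>n dvd k s\<^sub>i\<close> for all \<open>i \<in> I\<close>; summing over
  \<open>I\<close> first gives \<open>\<Prod> q\<^bsup>l\<^sub>i\<^esup>\<close> over all \<open>i\<close> with \<open>n dvd k s\<^sub>i\<close>, and the cosets of these \<open>s\<^sub>i\<close>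
  partition \<open>{z. n dvd k z}\<close>.\<close>

section \<open>Residues modulo n\<close>

lemma finite_Zmod [simp]: "finite (Zmod n)"
  by (simp add: Zmod_def)

lemma card_Zmod [simp]: "card (Zmod n) = n"
  by (simp add: Zmod_def)

lemma Zmod_eq_image: "Zmod n = int ` {..<n}"
  by (auto simp: Zmod_def image_int_atLeastLessThan lessThan_atLeast0)

lemma mod_in_Zmod [simp]: "0 < n \<Longrightarrow> x mod int n \<in> Zmod n"
  by (simp add: Zmod_def)

lemma mod_of_Zmod [simp]: "x \<in> Zmod n \<Longrightarrow> x mod int n = x"
  by (simp add: Zmod_def)

text \<open>The kernel of multiplication by \<open>k\<close> on the residues. Since the divisibility
  is symmetric in \<open>k\<close> and \<open>z\<close>, the same set also collects the multipliers
  that kill a given residue.\<close>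

definition annihilator :: "nat \<Rightarrow> int \<Rightarrow> int set" where
  "annihilator n k = {z \<in> Zmod n. int n dvd k * z}"

lemma finite_annihilator [simp]: "finite (annihilator n k)"
  by (simp add: annihilator_def)

text \<open>With \<open>d = gcd n k\<close> and \<open>n = d * e\<close>, the cofactor of
  \<open>k\<close> is coprime to \<open>e\<close>, so the condition on \<open>z\<close> becomes
  \<open>e dvd z\<close>; exactly \<open>d\<close> multiples of \<open>e\<close> lie below
  \<open>n\<close>.\<close>

lemma card_annihilator:
  assumes "0 < n"
  shows "int (card (annihilator n k)) = gcd (int n) k"
proof -
  define d where "d = gcd (int n) k"
  define e where "e = int n div d"
  have d: "d > 0" and n: "int n = d * e"
    using assms by (auto simp: d_def e_def)
  have e: "e > 0"
    using assms n d by (metis of_nat_0_less_iff zero_less_mult_pos)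
  obtain k' where k: "k = d * k'"
    unfolding d_def by (meson dvdE gcd_dvd2)
  have "gcd e k' = 1"
  proof -
    have "d * gcd e k' = d"
      using d by (metis abs_of_pos d_def gcd_mult_distrib_int k n)
    then show ?thesis using d by simp
  qed
  then have cop: "coprime e k'" by (simp add: coprime_iff_gcd_eq_1)
  have dvd_iff: "int n dvd k * z \<longleftrightarrow> e dvd z" for z
    using d cop by (simp add: n k mult.assoc coprime_dvd_mult_right_iff)
  have "annihilator n k = (\<lambda>j. e * j) ` {0..<d}"
  proof (intro equalityI subsetI)
    fix z assume "z \<in> annihilator n k"
    then have z: "0 \<le> z" "z < d * e" "e dvd z"
      by (auto simp: annihilator_def Zmod_def dvd_iff simp flip: n)
    then obtain j where j: "z = e * j" by auto
    then show "z \<in> (\<lambda>j. e * j) ` {0..<d}"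
      using z e by (auto simp: mult.commute[of d] zero_le_mult_iff)
  next
    fix z assume "z \<in> (\<lambda>j. e * j) ` {0..<d}"
    then obtain j where "j \<in> {0..<d}" and zj: "z = e * j" by blast
    then have j: "0 \<le> j" "j < d" by simp_all
    then have "0 \<le> z" "z < int n" using e by (auto simp: zj n mult.commute[of d])
    moreover have "int n dvd k * z" unfolding dvd_iff using zj by simp
    ultimately show "z \<in> annihilator n k" by (simp add: annihilator_def Zmod_def)
  qed
  moreover have "inj_on (\<lambda>j. e * j) {0..<d}"
    using e by (auto intro: inj_onI)
  ultimately show ?thesis
    using d by (simp add: card_image d_def)
qed

text \<open>The exponent is kept as a cardinality because characters and cosets produce it in this
  form; only the necklace count needs the gcd.\<close>

definition gcd_power_sum :: "nat \<Rightarrow> nat \<Rightarrow> nat" where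
  "gcd_power_sum q n = (\<Sum>k\<in>Zmod n. q ^ card (annihilator n k))"

lemma gcd_power_sum_eq:
  assumes "0 < n"
  shows "gcd_power_sum q n = (\<Sum>k<n. q ^ gcd n k)"
proof -
  have "card (annihilator n (int k)) = gcd n k" for k
    using card_annihilator[OF assms, of "int k"] by simp
  then show ?thesis
    by (simp add: gcd_power_sum_def Zmod_eq_image sum.reindex)
qed

lemma bij_betw_mult_Zmod:
  assumes "0 < n" "coprime q n"
  shows "bij_betw (\<lambda>z. int q * z mod int n) (Zmod n) (Zmod n)"
proof -
  have "inj_on (\<lambda>z. int q * z mod int n) (Zmod n)"
  proof (rule inj_onI)
    fix x y assume xy: "x \<in> Zmod n" "y \<in> Zmod n" "int q * x mod int n = int q * y mod int n"
    then have "[int q * x = int q * y] (mod int n)" by (simp add: cong_def)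
    then have "[x = y] (mod int n)"
      using assms by (simp add: cong_mult_lcancel)
    then show "x = y" using xy by (simp add: cong_def)
  qed
  moreover have "(\<lambda>z. int q * z mod int n) ` Zmod n \<subseteq> Zmod n"
    using assms by auto
  ultimately show ?thesis
    by (simp add: bij_betw_def endo_inj_surj)
qed

section \<open>Necklaces\<close>

lemma finite_words: "finite C \<Longrightarrow> finite (words n C)"
  unfolding words_def using finite_lists_length_eq by (auto simp: conj_commute)

lemma card_words: "finite C \<Longrightarrow> card (words n C) = card C ^ n"
  unfolding words_def using card_lists_length_eq by (simp add: conj_commute)

text \<open>Descent on the index: stepping back by \<open>d\<close> never wraps around the end of
  the word, so the rotation acts there as a plain shift.\<close>

lemma nth_eq_nth_mod_of_rotate_fixed:
  assumes "rotate d w = w" "d dvd length w" "i < length w"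
  shows "w ! i = w ! (i mod d)"
  using assms(3)
proof (induction i rule: less_induct)
  case (less i)
  show ?case
  proof (cases "i < d")
    case False
    have "d > 0" using assms(2) less.prems by (metis dvd_0_left gr_zeroI not_less0)
    have "w ! (i - d) = rotate d w ! (i - d)" using assms(1) by simp
    also have "\<dots> = w ! i" using less.prems False by (simp add: nth_rotate)
    finally have "w ! i = w ! (i - d)" ..
    also have "\<dots> = w ! ((i - d) mod d)"
      using less \<open>d > 0\<close> False by simp
    finally show ?thesis using False by (simp add: le_mod_geq)
  qed simp
qed

text \<open>The first \<open>d\<close> letters are free and determine the rest. Their periodic
  extension closes up cyclically because \<open>d\<close> divides \<open>n\<close>.\<close>

lemma card_words_fixed_dvd:
  assumes "finite C" "d dvd n" "0 < n"
  shows "card {w \<in> words n C. rotate d w = w} = card C ^ d"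
proof -
  have "d > 0" "d \<le> n" using assms by (auto intro: dvd_imp_le dvd_pos_nat)
  have "bij_betw (take d) {w \<in> words n C. rotate d w = w} (words d C)"
  proof (rule bij_betwI[where g = "\<lambda>v. map (\<lambda>i. v ! (i mod d)) [0..<n]"])
    show "take d \<in> {w \<in> words n C. rotate d w = w} \<rightarrow> words d C"
      using \<open>d \<le> n\<close> by (auto simp: words_def dest: in_set_takeD)
    show "(\<lambda>v. map (\<lambda>i. v ! (i mod d)) [0..<n]) \<in> words d C \<rightarrow> {w \<in> words n C. rotate d w = w}"
    proof
      fix v assume v: "v \<in> words d C"
      let ?w = "map (\<lambda>i. v ! (i mod d)) [0..<n]"
      have "rotate d ?w = ?w"
        using assms by (intro nth_equalityI) (auto simp: nth_rotate mod_mod_cancel)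
      moreover have "v ! (i mod d) \<in> C" for i
        using v \<open>d > 0\<close> by (auto simp: words_def)
      ultimately show "?w \<in> {w \<in> words n C. rotate d w = w}"
        by (auto simp: words_def)
    qed
    show "map (\<lambda>i. take d w ! (i mod d)) [0..<n] = w"
      if "w \<in> {w \<in> words n C. rotate d w = w}" for w
      using that \<open>d > 0\<close> assms nth_eq_nth_mod_of_rotate_fixed[of d w]
      by (intro nth_equalityI) (auto simp: words_def)
    show "take d (map (\<lambda>i. v ! (i mod d)) [0..<n]) = v" if "v \<in> words d C" for v
      using that \<open>d \<le> n\<close> by (intro nth_equalityI) (auto simp: words_def)
  qed
  then show ?thesis
    using assms(1) by (simp add: bij_betw_same_card card_words)
qed

lemma rotate_mult_fixed: "rotate k w = w \<Longrightarrow> rotate (k * j) w = w"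
  by (induction j) (auto simp: rotate_add)

text \<open>By Bezout, \<open>gcd n k\<close> is a multiple of \<open>k\<close> modulo
  \<open>n\<close>, and \<open>k\<close> is a multiple of \<open>gcd n k\<close>.\<close>

lemma rotate_fixed_iff_gcd:
  assumes "length w = n"
  shows "rotate k w = w \<longleftrightarrow> rotate (gcd n k) w = w"
proof
  assume fixed: "rotate k w = w"
  obtain x where "[k * x = gcd n k] (mod n)"
    using cong_solve_dvd_nat[of k n "gcd n k"] by auto
  then have "rotate (gcd n k) w = rotate (k * x) w"
    using assms by (metis cong_def rotate_conv_mod)
  then show "rotate (gcd n k) w = w" using fixed by (simp add: rotate_mult_fixed)
next
  assume "rotate (gcd n k) w = w"
  then show "rotate k w = w" by (metis dvd_div_mult_self gcd_dvd2 mult.commute rotate_mult_fixed)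
qed

lemma card_words_fixed:
  assumes "finite C" "0 < n"
  shows "card {w \<in> words n C. rotate k w = w} = card C ^ gcd n k"
proof -
  have "{w \<in> words n C. rotate k w = w} = {w \<in> words n C. rotate (gcd n k) w = w}"
    using rotate_fixed_iff_gcd by (auto simp: words_def)
  then show ?thesis using assms by (simp add: card_words_fixed_dvd)
qed

text \<open>The shift by \<open>r\<close> modulo \<open>n\<close> carries the stabilizer of
  \<open>rotate r w\<close> onto the set of rotations taking \<open>w\<close> there, which is one of
  its cosets. This replaces an appeal to group actions.\<close>

lemma card_rotations_fixing:
  assumes "length w = n" "0 < n"
  shows "card {k \<in> {..<n}. rotate k (rotate r w) = rotate r w} = card {j \<in> {..<n}. rotate j w = rotate r w}"
proof -
  have "bij_betw (\<lambda>k. (k + r) mod n) {..<n} {..<n}"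
  proof -
    have "inj_on (\<lambda>k. (k + r) mod n) {..<n}"
    proof (rule inj_onI)
      fix x y assume "x \<in> {..<n}" "y \<in> {..<n}" "(x + r) mod n = (y + r) mod n"
      then have "[x = y] (mod n)" by (metis cong_add_rcancel_nat cong_def)
      then show "x = y" using \<open>x \<in> {..<n}\<close> \<open>y \<in> {..<n}\<close> by (simp add: cong_def)
    qed
    moreover have "(\<lambda>k. (k + r) mod n) ` {..<n} \<subseteq> {..<n}" using assms by auto
    ultimately show ?thesis by (simp add: bij_betw_def endo_inj_surj)
  qed
  then have "bij_betw (\<lambda>k. (k + r) mod n) {k \<in> {..<n}. rotate k (rotate r w) = rotate r w}
      {j \<in> {..<n}. rotate j w = rotate r w}"
    using assms(1) rotate_conv_mod[of _ w]
    by (intro bij_betw_Collect) (auto simp: rotate_rotate)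
  then show ?thesis by (rule bij_betw_same_card)
qed

text \<open>Burnside's count of the pairs \<open>(k, u)\<close> with \<open>rotate k u = u\<close>:
  grouped by necklace, each class contributes \<open>n\<close>; grouped by \<open>k\<close>, the
  fixed words are counted.\<close>

lemma card_necklaces:
  assumes "finite C" "0 < n"
  shows "n * card (necklaces n C) = gcd_power_sum (card C) n"
proof -
  let ?stab = "\<lambda>u. card {k \<in> {..<n}. rotate k u = u}"
  have class_sum: "(\<Sum>u\<in>X. ?stab u) = n" if mem: "X \<in> necklaces n C" for X
  proof -
    obtain w where w: "w \<in> words n C" and X: "X = rotation_rel n C `` {w}"
      using mem unfolding necklaces_def by (auto elim: quotientE)
    have len: "length w = n" using w by (simp add: words_def)
    have img: "X = (\<lambda>k. rotate k w) ` {..<n}"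
    proof (intro equalityI subsetI)
      fix u assume "u \<in> X"
      then obtain k where "u = rotate k w" by (auto simp: X rotation_rel_def)
      then have "u = rotate (k mod n) w" using len rotate_conv_mod by metis
      then show "u \<in> (\<lambda>k. rotate k w) ` {..<n}" using assms(2) by auto
    qed (use w in \<open>auto simp: X rotation_rel_def words_def\<close>)
    have "(\<Sum>u\<in>X. ?stab u) = (\<Sum>u\<in>X. card {j \<in> {..<n}. rotate j w = u})"
      using card_rotations_fixing[OF len assms(2)] by (intro sum.cong) (auto simp: img)
    also have "\<dots> = (\<Sum>u\<in>X. \<Sum>j | j \<in> {..<n} \<and> rotate j w = u. 1)"
      by simp
    \<comment> \<open>Each \<open>j < n\<close> takes \<open>w\<close> to exactly one member of its
      class.\<close>
    also have "\<dots> = (\<Sum>j<n. 1)"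
      by (rule sum.group) (auto simp: img)
    finally show ?thesis by simp
  qed
  have eqv: "equiv (words n C) (rotation_rel n C)" by (rule equiv_rotation_rel)
  have "n * card (necklaces n C) = (\<Sum>X\<in>necklaces n C. n)"
    by simp
  also have "\<dots> = (\<Sum>X\<in>necklaces n C. \<Sum>u\<in>X. ?stab u)"
    using class_sum by (intro sum.cong) auto
  also have "\<dots> = (\<Sum>u\<in>\<Union>(necklaces n C). ?stab u)"
  proof (rule sum.Union_disjoint[symmetric, unfolded comp_def])
    show "\<forall>A\<in>necklaces n C. finite A"
      using assms finite_words eqv unfolding necklaces_def
      by (metis finite_subset in_quotient_imp_subset)
    show "\<forall>A\<in>necklaces n C. \<forall>B\<in>necklaces n C. A \<noteq> B \<longrightarrow> A \<inter> B = {}"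
      using quotient_disj[OF eqv] unfolding necklaces_def by blast
  qed
  also have "\<Union>(necklaces n C) = words n C"
    unfolding necklaces_def using eqv by (rule Union_quotient)
  \<comment> \<open>The double count changes here from words to rotations.\<close>
  also have "(\<Sum>u\<in>words n C. ?stab u) = (\<Sum>k<n. card {u \<in> words n C. rotate k u = u})"
    using assms finite_words by (intro sum_multicount_gen) auto
  also have "\<dots> = gcd_power_sum (card C) n"
    using assms by (simp add: card_words_fixed gcd_power_sum_eq)
  finally show ?thesis .
qed

section \<open>Zero-sum functions\<close>

definition echar :: "nat \<Rightarrow> int \<Rightarrow> complex" where
  "echar n t = cis (2 * pi * real_of_int t / real n)"

lemma echar_0 [simp]: "echar n 0 = 1"
  by (simp add: echar_def)

lemma echar_add: "echar n (a + b) = echar n a * echar n b"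
  by (simp add: echar_def cis_mult ring_distribs add_divide_distrib)

lemma echar_sum: "echar n (\<Sum>x\<in>A. f x) = (\<Prod>x\<in>A. echar n (f x))"
  by (induction A rule: infinite_finite_induct) (auto simp: echar_add)

lemma echar_mult_nat: "echar n (t * int a) = echar n t ^ a"
  by (simp add: echar_def DeMoivre mult_ac)

lemma echar_eq_1_iff:
  assumes "0 < n"
  shows "echar n t = 1 \<longleftrightarrow> int n dvd t"
proof
  assume "echar n t = 1"
  then have "cos (2 * pi * real_of_int t / real n) = 1"
    by (simp add: echar_def complex_eq_iff)
  then obtain j :: int where "2 * pi * real_of_int t / real n = j * 2 * pi"
    by (auto simp: cos_one_2pi_int)
  then have "real_of_int t = real_of_int (j * int n)"
    using assms by (simp add: field_simps)
  then show "int n dvd t" by (metis dvd_triv_right of_int_eq_iff)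
next
  assume "int n dvd t"
  then obtain j where "t = int n * j" by auto
  then have "2 * pi * real_of_int t / real n = 2 * pi * of_int j"
    using assms by simp
  then show "echar n t = 1" by (simp add: echar_def)
qed

lemma echar_mod:
  assumes "0 < n"
  shows "echar n (t mod int n) = echar n t"
proof -
  have "echar n t = echar n (int n * (t div int n)) * echar n (t mod int n)"
    by (simp flip: echar_add)
  also have "echar n (int n * (t div int n)) = 1"
    using assms by (simp add: echar_eq_1_iff)
  finally show ?thesis by simp
qed

text \<open>\<open>Zmod m\<close> serves only as a range of integers, with \<open>m\<close>
  unrelated to \<open>n\<close>; the cases used are \<open>m = n\<close> and
  \<open>m = q\<close>.\<close>

lemma sum_echar:
  "(\<Sum>a\<in>Zmod m. echar n (t * a)) = (\<Sum>a<m. echar n t ^ a)"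
  by (simp add: Zmod_eq_image sum.reindex echar_mult_nat)

text \<open>If \<open>n\<close> does not divide \<open>t\<close>, the ratio of the geometric sum is
  an \<open>n\<close>-th root of unity other than 1, so the sum vanishes.\<close>

lemma sum_echar_orthogonal:
  assumes "0 < n"
  shows "(\<Sum>k\<in>Zmod n. echar n (k * t)) = (if int n dvd t then of_nat n else 0)"
proof (cases "int n dvd t")
  case True
  then have "echar n (k * t) = 1" for k using assms by (simp add: echar_eq_1_iff)
  then show ?thesis using True by simp
next
  case False
  then have ne: "echar n t \<noteq> 1" using assms by (simp add: echar_eq_1_iff)
  have "echar n t ^ n = 1" using assms by (simp add: echar_eq_1_iff flip: echar_mult_nat)
  then have "(\<Sum>k<n. echar n t ^ k) = 0" using ne by (simp add: geometric_sum)
  then show ?thesis using False by (simp add: mult.commute[of _ t] sum_echar)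
qed

lemma prod_sum_echar:
  assumes "0 < n" "coprime q n"
  shows "(\<Prod>z\<in>Zmod n. \<Sum>a\<in>Zmod q. echar n (k * z * a)) = of_nat q ^ card (annihilator n k)"
proof -
  \<comment> \<open>\<open>B\<close> holds the \<open>z\<close> whose geometric ratio is not 1, so
    the closed form of the sum over \<open>a\<close> applies exactly there.\<close>
  define B where "B = {z \<in> Zmod n. \<not> int n dvd k * z}"
  have Zmod_split: "Zmod n = annihilator n k \<union> B" "annihilator n k \<inter> B = {}"
    by (auto simp: annihilator_def B_def)
  have fin: "finite B" by (simp add: B_def)
  have ne: "echar n (k * z) - 1 \<noteq> 0" if "z \<in> B" for z
    using that assms by (simp add: B_def echar_eq_1_iff)
  have "bij_betw (\<lambda>z. int q * z mod int n) B B"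
    unfolding B_def
  proof (rule bij_betw_Collect[OF bij_betw_mult_Zmod[OF assms]])
    fix z
    have "int n dvd k * (int q * z mod int n) \<longleftrightarrow> int n dvd k * (int q * z)"
      by (simp add: dvd_eq_mod_eq_0 mod_mult_right_eq)
    also have "\<dots> \<longleftrightarrow> int n dvd int q * (k * z)"
      by (simp add: mult.left_commute)
    also have "\<dots> \<longleftrightarrow> int n dvd k * z"
      using assms by (intro coprime_dvd_mult_right_iff) (simp add: coprime_commute)
    finally show "(\<not> int n dvd k * (int q * z mod int n)) \<longleftrightarrow> (\<not> int n dvd k * z)"
      by simp
  qed
  then have perm: "(\<Prod>z\<in>B. echar n (k * z) - 1) = (\<Prod>z\<in>B. echar n (k * (int q * z mod int n)) - 1)"
    by (rule prod.reindex_bij_betw[symmetric])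
  have pow: "echar n (k * (int q * z mod int n)) = echar n (k * z) ^ q" for z
  proof -
    have "echar n (k * (int q * z mod int n)) = echar n (k * (int q * z))"
      using assms(1) by (metis echar_mod mod_mult_right_eq)
    then show ?thesis by (simp add: mult_ac flip: echar_mult_nat)
  qed
  have "(\<Prod>z\<in>B. \<Sum>a\<in>Zmod q. echar n (k * z * a)) = (\<Prod>z\<in>B. (echar n (k * z) ^ q - 1) / (echar n (k * z) - 1))"
    using ne by (intro prod.cong) (simp_all add: sum_echar geometric_sum)
  also have "\<dots> = (\<Prod>z\<in>B. echar n (k * z) ^ q - 1) / (\<Prod>z\<in>B. echar n (k * z) - 1)"
    by (rule prod_dividef)
  also have "(\<Prod>z\<in>B. echar n (k * z) ^ q - 1) = (\<Prod>z\<in>B. echar n (k * z) - 1)"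
    using perm by (simp add: pow)
  also have "(\<Prod>z\<in>B. echar n (k * z) - 1) / (\<Prod>z\<in>B. echar n (k * z) - 1) = 1"
    using ne fin by (intro divide_self) (simp add: prod_zero_iff)
  finally have "(\<Prod>z\<in>B. \<Sum>a\<in>Zmod q. echar n (k * z * a)) = 1" .
  moreover have "(\<Sum>a\<in>Zmod q. echar n (k * z * a)) = of_nat q" if "z \<in> annihilator n k" for z
  proof -
    have "echar n (k * z) = 1" using that assms by (simp add: annihilator_def echar_eq_1_iff)
    then show ?thesis by (simp add: sum_echar)
  qed
  ultimately show ?thesis
    using Zmod_split fin by (simp add: prod.union_disjoint)
qed

lemma card_zero_sum_functions:
  assumes "0 < n" "coprime q n"
  shows "n * card (zero_sum_functions q n) = gcd_power_sum q n"
proof -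
  let ?F = "Zmod n \<rightarrow>\<^sub>E Zmod q"
  have fin: "finite ?F" by (intro finite_PiE) auto
  have zsf: "zero_sum_functions q n = {f \<in> ?F. int n dvd (\<Sum>z\<in>Zmod n. z * f z)}"
    by (simp add: zero_sum_functions_def Zmod_def cong_0_iff)
  have "of_nat (n * card (zero_sum_functions q n)) =
      (\<Sum>f\<in>?F. if int n dvd (\<Sum>z\<in>Zmod n. z * f z) then of_nat n else 0 :: complex)"
    using fin by (simp add: zsf flip: sum.inter_filter)
  also have "\<dots> = (\<Sum>f\<in>?F. \<Sum>k\<in>Zmod n. echar n (k * (\<Sum>z\<in>Zmod n. z * f z)))"
    using assms by (simp add: sum_echar_orthogonal)
  also have "\<dots> = (\<Sum>k\<in>Zmod n. \<Sum>f\<in>?F. \<Prod>z\<in>Zmod n. echar n (k * z * f z))"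
    by (subst sum.swap) (simp add: sum_distrib_left echar_sum mult.assoc)
  \<comment> \<open>Distributivity: the values of \<open>f\<close> at different residues are chosen
    independently.\<close>
  also have "\<dots> = (\<Sum>k\<in>Zmod n. \<Prod>z\<in>Zmod n. \<Sum>a\<in>Zmod q. echar n (k * z * a))"
    by (simp add: prod_sum_PiE)
  also have "\<dots> = of_nat (gcd_power_sum q n)"
    using assms by (simp add: prod_sum_echar gcd_power_sum_def)
  finally show ?thesis by (simp only: of_nat_eq_iff)
qed

section \<open>Cyclotomic cosets\<close>

text \<open>Pigeonhole: the \<open>n + 1\<close> powers with exponents up to \<open>n\<close> repeat
  modulo \<open>n\<close>, and the smaller power cancels.\<close>

lemma cong_power_one_exists:
  assumes "0 < n" "coprime q n"
  obtains t where "0 < t" "[int q ^ t = 1] (mod int n)"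
proof -
  have "\<not> inj_on (\<lambda>j. int q ^ j mod int n) {..n}"
  proof
    assume "inj_on (\<lambda>j. int q ^ j mod int n) {..n}"
    moreover have "(\<lambda>j. int q ^ j mod int n) ` {..n} \<subseteq> Zmod n" using assms by auto
    ultimately have "card {..n} \<le> card (Zmod n)" by (intro card_inj_on_le) auto
    then show False by simp
  qed
  then obtain i j where "i \<noteq> j" "[int q ^ i = int q ^ j] (mod int n)"
    unfolding inj_on_def cong_def by blast
  then obtain i j where ij: "i < j" "[int q ^ i = int q ^ j] (mod int n)"
    by (metis cong_sym linorder_neqE_nat)
  then have "[int q ^ i * int q ^ (j - i) = int q ^ i * 1] (mod int n)"
    by (simp flip: power_add add: cong_sym)
  then have "[int q ^ (j - i) = 1] (mod int n)"
    using assms(2) by (subst (asm) cong_mult_lcancel) auto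
  then show ?thesis using that ij(1) by (metis zero_less_diff)
qed

text \<open>The generated equivalence also permits backward steps, but \<open>q\<close> has finite
  order \<open>t\<close> modulo \<open>n\<close>, so each of them is \<open>t - 1\<close> forward
  steps. Classes are therefore forward orbits.\<close>

lemma equivclp_cyclotomic_iff:
  assumes "0 < n" "coprime q n" "x \<in> Zmod n"
  shows "equivclp (\<lambda>a b. a \<in> Zmod n \<and> b = int q * a mod int n) x y
    \<longleftrightarrow> (\<exists>j. y = int q ^ j * x mod int n)"
proof
  let ?R = "\<lambda>a b. a \<in> Zmod n \<and> b = int q * a mod int n"
  obtain t where t: "0 < t" "[int q ^ t = 1] (mod int n)"
    using assms cong_power_one_exists by metis
  show "\<exists>j. y = int q ^ j * x mod int n" if "equivclp ?R x y"
    using that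
  proof (induction rule: equivclp_induct)
    case base
    have "x = int q ^ 0 * x mod int n" using assms by simp
    then show ?case ..
  next
    case (step y z)
    then obtain j where j: "y = int q ^ j * x mod int n" by blast
    from step.hyps(2) show ?case
    proof
      assume "?R y z"
      then have "z = int q ^ Suc j * x mod int n"
        by (simp add: j mod_mult_right_eq mult.assoc)
      then show ?thesis ..
    next
      assume R: "?R z y"
      have "[int q ^ (j + (t - 1)) * x = int q ^ (t - 1) * y] (mod int n)"
        by (simp add: j power_add mult_ac cong_def mod_mult_right_eq)
      also have "[int q ^ (t - 1) * y = int q ^ (t - 1) * (int q * z)] (mod int n)"
        using R by (simp add: cong_def mod_mult_right_eq)
      also have "int q ^ (t - 1) * (int q * z) = int q ^ t * z"
        using t(1) by (metis mult.assoc power_minus_mult)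
      also have "[int q ^ t * z = 1 * z] (mod int n)"
        using t(2) by (rule cong_scalar_right)
      finally have "z = int q ^ (j + (t - 1)) * x mod int n"
        using R by (simp add: cong_def)
      then show ?thesis ..
    qed
  qed
  show "equivclp ?R x y" if ex: "\<exists>j. y = int q ^ j * x mod int n"
  proof -
    obtain j where "y = int q ^ j * x mod int n" using ex by blast
    then show ?thesis
    proof (induction j arbitrary: y)
      case 0
      then show ?case using assms by simp
    next
      case (Suc j)
      have "?R (int q ^ j * x mod int n) y"
        using assms by (simp add: Suc.prems mod_mult_right_eq mult.assoc)
      then show ?case by (intro equivclp_into_equivclp[OF Suc.IH[OF refl]] disjI1)
    qed
  qed
qed

text \<open>An exponent with \<open>q ^ t\<close> congruent to 1 shows that the \<open>LEAST\<close>
  ranges over a nonempty set.\<close>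

lemma coset_length:
  assumes "0 < n" "coprime q n"
  shows "0 < coset_length q n s" "[int q ^ coset_length q n s * s = s] (mod int n)"
proof -
  obtain t where t: "0 < t" "[int q ^ t = 1] (mod int n)"
    using assms cong_power_one_exists by metis
  then have "[int q ^ t * s = s] (mod int n)"
    using cong_scalar_right by fastforce
  then have "0 < coset_length q n s \<and> [int q ^ coset_length q n s * s = s] (mod int n)"
    unfolding coset_length_def using t(1) by (intro LeastI) auto
  then show "0 < coset_length q n s" "[int q ^ coset_length q n s * s = s] (mod int n)"
    by auto
qed

lemma cyclotomic_class_eq:
  assumes "0 < n" "coprime q n"
  shows "cyclotomic_rel q n `` {s mod int n} = range (\<lambda>j. int q ^ j * s mod int n)"
  using assms by (auto simp: cyclotomic_rel_def equivclp_cyclotomic_iff mod_mult_right_eq)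

text \<open>The orbit sequence has period \<open>l\<close>, and minimality of \<open>l\<close> makes
  its first \<open>l\<close> terms distinct.\<close>

lemma card_cyclotomic_class:
  assumes "0 < n" "coprime q n"
  shows "card (cyclotomic_rel q n `` {s mod int n}) = coset_length q n s"
proof -
  define l where "l = coset_length q n s"
  let ?f = "\<lambda>j. int q ^ j * s mod int n"
  have l: "0 < l" "[int q ^ l * s = s] (mod int n)"
    using coset_length[OF assms] by (auto simp: l_def)
  have shift: "?f (j + l) = ?f j" for j
    using cong_scalar_left[OF l(2), of "int q ^ j"] by (simp add: cong_def power_add mult.assoc)
  have "?f j = ?f (j mod l)" for j
  proof -
    have "?f (i + l * c) = ?f i" for i c
      by (induction c) (simp_all add: shift[of "i + l * _", simplified add_ac] add_ac)
    from this[of "j mod l" "j div l"] show ?thesis by simp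
  qed
  then have "range ?f = ?f ` {..<l}"
    using l(1) by (auto simp: image_iff intro: mod_less_divisor)
  moreover have "inj_on ?f {..<l}"
  proof (rule linorder_inj_onI)
    fix i j assume ij: "i < j" "i \<in> {..<l}" "j \<in> {..<l}"
    show "?f i \<noteq> ?f j"
    proof
      assume "?f i = ?f j"
      moreover have "int q ^ j = int q ^ i * int q ^ (j - i)"
        using ij by (simp flip: power_add)
      ultimately have "[int q ^ i * (int q ^ (j - i) * s) = int q ^ i * s] (mod int n)"
        by (simp add: cong_def mult.assoc)
      then have "[int q ^ (j - i) * s = s] (mod int n)"
        using assms(2) by (subst (asm) cong_mult_lcancel) auto
      \<comment> \<open>Cancelling \<open>q ^ i\<close> from a repetition leaves a return time
        shorter than \<open>l\<close>.\<close>
      then have "l \<le> j - i"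
        unfolding l_def coset_length_def using ij by (intro Least_le) auto
      then show False using ij by auto
    qed
  qed auto
  ultimately show ?thesis
    using assms by (simp add: cyclotomic_class_eq card_image flip: l_def)
qed

text \<open>Powers of \<open>q\<close> are units modulo \<open>n\<close>, so divisibility of
  \<open>k * z\<close> by \<open>n\<close> is constant on each coset: the annihilator is a disjoint
  union of whole cosets.\<close>

lemma card_annihilator_eq_sum_coset_length:
  assumes "0 < n" "coprime q n" "represents_classes q n m s"
  shows "card (annihilator n k) = (\<Sum>i | i \<in> {1..m} \<and> int n dvd k * s i. coset_length q n (s i))"
proof -
  let ?J = "{i \<in> {1..m}. int n dvd k * s i}"
  define cls where "cls = (\<lambda>i. cyclotomic_rel q n `` {s i mod int n})"
  have bij: "bij_betw cls {1..m} (Zmod n // cyclotomic_rel q n)"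
    using assms(3) by (simp add: represents_classes_def cls_def)
  have eqv: "equiv (Zmod n) (cyclotomic_rel q n)" by (rule equiv_cyclotomic_rel)
  have cls_eq: "cls i = range (\<lambda>j. int q ^ j * s i mod int n)" for i
    using assms by (simp add: cls_def cyclotomic_class_eq)
  have inv: "int n dvd k * z \<longleftrightarrow> int n dvd k * s i" if z: "z \<in> cls i" for z i
  proof -
    obtain j where "z = int q ^ j * s i mod int n" using z cls_eq by auto
    then have "int n dvd k * z \<longleftrightarrow> int n dvd k * (int q ^ j * s i)"
      by (simp add: dvd_eq_mod_eq_0 mod_mult_right_eq)
    also have "\<dots> \<longleftrightarrow> int n dvd int q ^ j * (k * s i)"
      by (simp add: mult.left_commute)
    also have "\<dots> \<longleftrightarrow> int n dvd k * s i"
      using assms by (intro coprime_dvd_mult_right_iff) (simp add: coprime_commute)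
    finally show ?thesis .
  qed
  have sub: "cls i \<subseteq> Zmod n" for i using assms by (auto simp: cls_eq)
  have cover: "\<exists>i\<in>{1..m}. z \<in> cls i" if "z \<in> Zmod n" for z
  proof -
    have "z \<in> \<Union>(cls ` {1..m})"
      using that bij Union_quotient[OF eqv] by (simp add: bij_betw_def)
    then show ?thesis by auto
  qed
  have "annihilator n k = (\<Union>i\<in>?J. cls i)"
    using cover inv sub by (fastforce simp: annihilator_def)
  moreover have "card (\<Union>i\<in>?J. cls i) = (\<Sum>i\<in>?J. card (cls i))"
  proof (rule card_UN_disjoint)
    show "\<forall>i\<in>?J. finite (cls i)" using sub finite_subset finite_Zmod by blast
    show "\<forall>i\<in>?J. \<forall>j\<in>?J. i \<noteq> j \<longrightarrow> cls i \<inter> cls j = {}"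
    proof (intro ballI impI)
      fix i j assume ij: "i \<in> ?J" "j \<in> ?J" "i \<noteq> j"
      then have "cls i \<noteq> cls j" using bij by (metis (lifting) bij_betw_def inj_onD mem_Collect_eq)
      moreover have "cls i \<in> Zmod n // cyclotomic_rel q n" "cls j \<in> Zmod n // cyclotomic_rel q n"
        using ij bij_betw_apply[OF bij] by blast+
      ultimately show "cls i \<inter> cls j = {}" using quotient_disj[OF eqv] by blast
    qed
  qed simp
  ultimately show ?thesis
    using assms by (simp add: cls_def card_cyclotomic_class)
qed

section \<open>The sum over sets of cosets\<close>

lemma prod_one_plus:
  fixes f :: "'a \<Rightarrow> 'b :: comm_semiring_1"
  assumes "finite A"
  shows "(\<Prod>i\<in>A. f i + 1) = (\<Sum>I\<in>Pow A. \<Prod>i\<in>I. f i)"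
  using prod_add[OF assms, of f "\<lambda>_. 1"] by simp

lemma gcd_Gcd_eq_card:
  fixes s :: "'a \<Rightarrow> int"
  assumes "0 < n"
  shows "gcd (int n) (Gcd (s ` I)) = int (card {k \<in> Zmod n. \<forall>i\<in>I. int n dvd k * s i})"
proof -
  have "int n dvd k * Gcd (s ` I) \<longleftrightarrow> (\<forall>i\<in>I. int n dvd k * s i)" for k
  proof -
    have "int n dvd k * Gcd (s ` I) \<longleftrightarrow> int n dvd Gcd ((*) k ` s ` I)"
      by (simp only: Gcd_mult dvd_normalize_iff)
    then show ?thesis by (simp add: dvd_Gcd_iff)
  qed
  then have "annihilator n (Gcd (s ` I)) = {k \<in> Zmod n. \<forall>i\<in>I. int n dvd k * s i}"
    by (simp add: annihilator_def mult.commute[of "Gcd _"])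
  then show ?thesis using card_annihilator[OF assms, of "Gcd (s ` I)"] by simp
qed

lemma sum_subsets_eq_gcd_power_sum:
  assumes "0 < q" "0 < n" "coprime q n" "represents_classes q n m s"
  shows "(\<Sum>I\<in>Pow {1..m}. real_of_int (gcd (int n) (Gcd (s ` I)))
           * (\<Prod>i\<in>I. (real q ^ coset_length q n (s i) - 1))) = real (gcd_power_sum q n)"
proof -
  let ?p = "\<lambda>I. \<Prod>i\<in>I. (real q ^ coset_length q n (s i) - 1)"
  let ?J = "\<lambda>k. {i \<in> {1..m}. int n dvd k * s i}"
  have "(\<Sum>I\<in>Pow {1..m}. real_of_int (gcd (int n) (Gcd (s ` I))) * ?p I)
      = (\<Sum>I\<in>Pow {1..m}. \<Sum>k | k \<in> Zmod n \<and> (\<forall>i\<in>I. int n dvd k * s i). ?p I)"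
    using assms(2) by (simp add: gcd_Gcd_eq_card)
  \<comment> \<open>With \<open>k\<close> fixed first, the admissible \<open>I\<close> are exactly
    the subsets of \<open>?J k\<close>.\<close>
  also have "\<dots> = (\<Sum>k\<in>Zmod n. \<Sum>I | I \<in> Pow {1..m} \<and> (\<forall>i\<in>I. int n dvd k * s i). ?p I)"
    by (rule sum.swap_restrict) auto
  also have "\<dots> = (\<Sum>k\<in>Zmod n. \<Sum>I\<in>Pow (?J k). ?p I)"
    by (intro sum.cong) auto
  \<comment> \<open>Each factor is \<open>(q ^ l - 1) + 1\<close> with \<open>l\<close> the coset
    length; expanding the product gives the sum over subsets.\<close>
  also have "\<dots> = (\<Sum>k\<in>Zmod n. \<Prod>i\<in>?J k. real q ^ coset_length q n (s i))"
    by (simp flip: prod_one_plus)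
  also have "\<dots> = real (gcd_power_sum q n)"
    using assms by (simp add: gcd_power_sum_def power_sum card_annihilator_eq_sum_coset_length)
  finally show ?thesis .
qed

theorem theorem1p1:
  fixes q n m :: nat and C :: "'c set" and s :: "nat \<Rightarrow> int"
  assumes "0 < q" and "0 < n" and "coprime q n"
    and "finite C" and "card C = q"
    and "represents_classes q n m s"
  shows "card (necklaces n C) = card (zero_sum_functions q n)
    \<and> real (card (zero_sum_functions q n)) =
        (\<Sum>I\<in>Pow {1..m}. real_of_int (gcd (int n) (Gcd (s ` I))) / real n
           * (\<Prod>i\<in>I. (real q ^ coset_length q n (s i) - 1)))"
proof
  have neck: "n * card (necklaces n C) = gcd_power_sum q n"
    using card_necklaces assms by metis
  have zsf: "n * card (zero_sum_functions q n) = gcd_power_sum q n"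
    using card_zero_sum_functions assms by metis
  show "card (necklaces n C) = card (zero_sum_functions q n)"
    using neck zsf assms(2) by (metis mult_left_cancel neq0_conv)
  \<comment> \<open>The identity is first obtained with the denominator \<open>n\<close>
    cleared.\<close>
  have "real n * real (card (zero_sum_functions q n)) =
      (\<Sum>I\<in>Pow {1..m}. real_of_int (gcd (int n) (Gcd (s ` I)))
           * (\<Prod>i\<in>I. (real q ^ coset_length q n (s i) - 1)))"
    unfolding sum_subsets_eq_gcd_power_sum[OF assms(1-3,6)] zsf[symmetric] by simp
  then show "real (card (zero_sum_functions q n)) =
        (\<Sum>I\<in>Pow {1..m}. real_of_int (gcd (int n) (Gcd (s ` I))) / real n
           * (\<Prod>i\<in>I. (real q ^ coset_length q n (s i) - 1)))"
    using assms(2) by (simp add: nonzero_eq_divide_eq mult.commute flip: sum_divide_distrib)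
qed

end
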